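(* Let $d\ge2$ and suppose $|X|=1$, so that $X$ is a one-element set $X_d$. Let the set of forbidden patterns consist of a single pattern $P\in\mathcal{LT}(X)$ with $k\ge2$ internal vertices. Then for every pair $(d,k)$ other than $(2,2)$, $(2,3)$, $(2,4)$, $(3,2)$ there exists a positive number $C$, depending only on $d$ and $k$ and not on $P$, such that for all $n\ge1$ $$|\mathcal{LT}_{n,\mathrm{no}\text{-}P}(X)|\ \ge\ C^{\,n-1}\,|\mathcal{LT}_n(X)|.$$
   Context: Here all internal vertices of trees have exactly $d$ children and carry the same (unique) label. A planar $X$-labelled rooted tree is a planar rooted tree (children ordered left to right) with all internal vertices having $d$ children, whose leaves are labelled bijectively by $\{1,\dots,l\}$ ($l$ = number of leaves) so that, if each internal vertex is assigned the minimum label of the leaves descending from it, the numbers assigned to the children of every internal vertex increase from left to right. $\mathcal{LT}_l(X)$ is the set of such trees with $l$ leaves. A subtree of $T$ is a subtree $S$ rooted at an internal vertex of $T$ such that for every internal vertex of $S$ all its children in $T$ are children in $S$; its leaves carry the assigned integers, and relabelling them order-preservingly by $1,\dots,l$ gives the standardisation $\mathrm{st}(S)$. $T$ avoids $P$ if $P\neq\mathrm{st}(S)$ for every subtree $S$ of $T$; $\mathcal{LT}_{n,\mathrm{no}\text{-}P}(X)$ is the set of trees with $n$ leaves avoiding $P$. *)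

theory Defs
  imports Complex_Main
begin

text \<open>
  Internal vertices all carry the same label, so it is not recorded.
\<close>

datatype (leaf_labels: 'a) ptree = Leaf 'a | Node "'a ptree list"
  for map: relabel

fun leaves :: "'a ptree \<Rightarrow> 'a list" where
  "leaves (Leaf a) = [a]"
| "leaves (Node ts) = concat (map leaves ts)"

fun num_internal :: "'a ptree \<Rightarrow> nat" where
  "num_internal (Leaf a) = 0"
| "num_internal (Node ts) = Suc (sum_list (map num_internal ts))"

fun all_arity :: "nat \<Rightarrow> 'a ptree \<Rightarrow> bool" where
  "all_arity d (Leaf a) \<longleftrightarrow> True"
| "all_arity d (Node ts) \<longleftrightarrow> length ts = d \<and> (\<forall>t\<in>set ts. all_arity d t)"

definition min_label :: "'a::linorder ptree \<Rightarrow> 'a" where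
  "min_label t = Min (leaf_labels t)"

fun increasing :: "'a::linorder ptree \<Rightarrow> bool" where
  "increasing (Leaf a) \<longleftrightarrow> True"
| "increasing (Node ts) \<longleftrightarrow>
     sorted_wrt (<) (map min_label ts) \<and> (\<forall>t\<in>set ts. increasing t)"

definition LT :: "nat \<Rightarrow> nat \<Rightarrow> nat ptree set" where
  "LT d l = {t. all_arity d t \<and> distinct (leaves t) \<and> set (leaves t) = {1..l} \<and> increasing t}"

text \<open>The tree hanging below each vertex, leaves of the tree included.\<close>

fun vertex_trees :: "'a ptree \<Rightarrow> 'a ptree set" where
  "vertex_trees (Leaf a) = {Leaf a}"
| "vertex_trees (Node ts) = insert (Node ts) (\<Union>t\<in>set ts. vertex_trees t)"

text \<open>
  \<open>truncation S t\<close>: the tree \<open>S\<close> has the same root as \<open>t\<close>, and every internal vertex of \<open>S\<close>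
  keeps all its children; a vertex of \<open>t\<close> at which \<open>S\<close> stops becomes a leaf carrying the
  minimum of the leaf labels below it.
\<close>

inductive truncation :: "'a::linorder ptree \<Rightarrow> 'a ptree \<Rightarrow> bool" where
  cut: "truncation (Leaf (min_label t)) t"
| keep: "list_all2 truncation ss ts \<Longrightarrow> truncation (Node ss) (Node ts)"

text \<open>
  The one-vertex subtree is allowed here; it is never equal, after standardisation, to a
  pattern with an internal vertex.
\<close>

definition is_subtree :: "'a::linorder ptree \<Rightarrow> 'a ptree \<Rightarrow> bool" where
  "is_subtree S t \<longleftrightarrow> (\<exists>ts. Node ts \<in> vertex_trees t \<and> truncation S (Node ts))"

definition standardise :: "'a::linorder ptree \<Rightarrow> nat ptree" where
  "standardise S = relabel (\<lambda>x. card {y \<in> leaf_labels S. y \<le> x}) S"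

definition avoids :: "nat ptree \<Rightarrow> nat ptree \<Rightarrow> bool" where
  "avoids t P \<longleftrightarrow> (\<forall>S. is_subtree S t \<longrightarrow> P \<noteq> standardise S)"

definition LT_avoiding :: "nat \<Rightarrow> nat ptree \<Rightarrow> nat \<Rightarrow> nat ptree set" where
  "LT_avoiding d P n = {t \<in> LT d n. avoids t P}"

end

theory Submission
  imports Defs "HOL-Combinatorics.Multiset_Permutations"
begin

text \<open>
  Since \<open>|LT\<^sub>n|\<close> is at most exponential in \<open>n\<close> times \<open>n!\<close> (a tree is determined by its shape and the word
  of its leaves), it suffices to find \<open>c\<^sup>n n!\<close> trees that avoid \<open>P\<close>, and this is possible by
  shape alone. If some vertex of \<open>P\<close> has an internal child other than the first one, all
  left combs avoid \<open>P\<close>. Otherwise \<open>P\<close> is itself a left comb, and it is avoided by every tree in which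
  no run of first-child edges meets more than one internal vertex (two, if \<open>d = 2\<close>). Among the
  latter, take those in which the labels remaining after the removal of a few minimal ones are split
  evenly between two subtrees at each step: the number of increasing labellings of a balanced tree
  loses only an exponential factor against \<open>n!\<close>.
\<close>

section \<open>Leaves and labels\<close>

lemma set_leaves: "set (leaves t) = leaf_labels t"
  by (induction t) auto

text \<open>Each internal vertex replaces one leaf by \<open>d\<close>, a net gain of
  \<open>d - 1\<close>.\<close>

lemma length_leaves:
  "all_arity d t \<Longrightarrow> d \<ge> 1 \<Longrightarrow> length (leaves t) = 1 + (d - 1) * num_internal t"
proof (induction t)
  case (Node ts)
  have "length (concat (map leaves ts)) = length ts + (d - 1) * sum_list (map num_internal ts)"
    if "\<forall>t\<in>set ts. length (leaves t) = 1 + (d - 1) * num_internal t" for ts :: "'a ptree list"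
    using that by (induction ts) (auto simp: algebra_simps)
  from this[of ts] show ?case using Node by auto
qed simp

lemma min_label_Leaf [simp]: "min_label (Leaf a) = a"
  by (simp add: min_label_def)

lemma min_label_eq: "min_label t = Min (set (leaves t))"
  by (simp add: min_label_def set_leaves)

section \<open>Labelled trees over an arbitrary label set\<close>

text \<open>Label sets are arbitrary because the recursions hang trees carrying part of the labels
  below a root; \<open>p\<close> holds the restriction on the shape.\<close>

definition trees_on :: "nat \<Rightarrow> (nat ptree \<Rightarrow> bool) \<Rightarrow> nat set \<Rightarrow> nat ptree set" where
  "trees_on d p A =
     {t. all_arity d t \<and> distinct (leaves t) \<and> set (leaves t) = A \<and> increasing t \<and> p t}"

text \<open>Polish notation for the unlabelled tree: with a fixed arity the preorder word can be
  decoded without brackets.\<close>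

fun shape :: "'a ptree \<Rightarrow> bool list" where
  "shape (Leaf a) = [False]"
| "shape (Node ts) = True # concat (map shape ts)"

lemma length_shape: "length (shape t) = length (leaves t) + num_internal t"
proof (induction t)
  case (Node ts)
  have "length (concat (map shape ts)) = length (concat (map leaves ts)) + sum_list (map num_internal ts)"
    if "\<forall>t\<in>set ts. length (shape t) = length (leaves t) + num_internal t" for ts :: "'a ptree list"
    using that by (induction ts) auto
  from this[of ts] show ?case using Node by auto
qed simp

text \<open>
  The trailing words make the claim strong enough to pass from a tree to a list of children:
  the first child is read off unambiguously from a longer word.
\<close>

lemma shape_leaves_unique:
  assumes "all_arity d t" "all_arity d t'"
    "shape t @ xs = shape t' @ xs'" "leaves t @ ys = leaves t' @ ys'"
  shows "t = t' \<and> xs = xs' \<and> ys = ys'"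
  using assms
proof (induction t arbitrary: t' xs xs' ys ys')
  case (Leaf a)
  then show ?case by (cases t') auto
next
  case (Node ts)
  then obtain ts' where t': "t' = Node ts'" by (cases t') auto
  have "ts = ts' \<and> xs = xs' \<and> ys = ys'"
    if "length ts = length ts'" "\<forall>t\<in>set ts. all_arity d t" "\<forall>t\<in>set ts'. all_arity d t"
      "concat (map shape ts) @ xs = concat (map shape ts') @ xs'"
      "concat (map leaves ts) @ ys = concat (map leaves ts') @ ys'"
    using that Node.IH
  proof (induction ts ts' rule: list_induct2)
    case (Cons s ss s' ss')
    have head: "s = s' \<and> concat (map shape ss) @ xs = concat (map shape ss') @ xs'
        \<and> concat (map leaves ss) @ ys = concat (map leaves ss') @ ys'"
    proof (rule Cons.prems(5))
      show "shape s @ concat (map shape ss) @ xs = shape s' @ concat (map shape ss') @ xs'"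
        using Cons.prems(3) by (simp only: list.map concat.simps append_assoc)
      show "leaves s @ concat (map leaves ss) @ ys = leaves s' @ concat (map leaves ss') @ ys'"
        using Cons.prems(4) by (simp only: list.map concat.simps append_assoc)
    qed (use Cons.prems(1,2) in simp_all)
    have "ss = ss' \<and> xs = xs' \<and> ys = ys'"
    proof (rule Cons.IH)
      show "concat (map shape ss) @ xs = concat (map shape ss') @ xs'"
        "concat (map leaves ss) @ ys = concat (map leaves ss') @ ys'" using head by blast+
      show "x = t' \<and> us = us' \<and> vs = vs'"
        if "x \<in> set ss" "all_arity d x" "all_arity d t'" "shape x @ us = shape t' @ us'"
          "leaves x @ vs = leaves t' @ vs'" for x t' us us' vs vs'
        by (rule Cons.prems(5)) (use that in simp_all)
    qed (use Cons.prems(1,2) in simp_all)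
    with head show ?case by simp
  qed simp
  with Node.prems t' show ?case by auto
qed

section \<open>Upper bounds for the number of trees\<close>

text \<open>The pair of shape word and leaf word determines the tree. The first is a bit string of
  length at most \<open>2 * card A - 1\<close>, the second a permutation of
  \<open>A\<close>.\<close>

lemma card_trees_on:
  assumes "d \<ge> 2" "finite A"
  shows "finite (trees_on d p A)" "card (trees_on d p A) \<le> 4 ^ card A * fact (card A)"
proof -
  let ?W = "{xs :: bool list. set xs \<subseteq> UNIV \<and> length xs \<le> 2 * card A - 1}"
  let ?f = "\<lambda>t. (shape t, leaves t)"
  have inj: "inj_on ?f (trees_on d p A)"
    using shape_leaves_unique[where d = d and xs = "[]" and xs' = "[]" and ys = "[]" and ys' = "[]"]
    by (auto simp: inj_on_def trees_on_def)
  have sub: "?f ` trees_on d p A \<subseteq> ?W \<times> permutations_of_set A"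
  proof (rule image_subsetI)
    fix t assume t: "t \<in> trees_on d p A"
    then have len: "length (leaves t) = card A"
      by (auto simp: trees_on_def distinct_card)
    moreover have "length (leaves t) = 1 + (d - 1) * num_internal t"
      using t assms by (intro length_leaves) (auto simp: trees_on_def)
    \<comment> \<open>As \<open>d - 1 \<ge> 1\<close>, there are fewer internal vertices than
      leaves.\<close>
    moreover have "1 * num_internal t \<le> (d - 1) * num_internal t"
      using assms by (intro mult_right_mono) auto
    ultimately have "length (shape t) \<le> 2 * card A - 1"
      unfolding length_shape by linarith
    with t show "?f t \<in> ?W \<times> permutations_of_set A"
      by (auto simp: trees_on_def permutations_of_set_def)
  qed
  have W: "finite ?W" "card ?W \<le> 4 ^ card A"
  proof -
    show "finite ?W" by (rule finite_lists_length_le) simp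
    have "card ?W = (\<Sum>i\<le>2 * card A - 1. 2 ^ i)"
      by (subst card_lists_length_le) simp_all
    also have "\<dots> = 2 ^ Suc (2 * card A - 1) - 1"
      using sum_power2[of "Suc (2 * card A - 1)"] by (simp add: atLeast0LessThan lessThan_Suc_atMost)
    also have "\<dots> \<le> 4 ^ card A"
    \<comment> \<open>For empty \<open>A\<close> the truncated subtraction gives length bound
      \<open>0\<close> instead of \<open>-1\<close>, so this case is checked apart.\<close>
    proof (cases "card A = 0")
      case False
      then have "Suc (2 * card A - 1) = 2 * card A" by simp
      then show ?thesis by (simp only: power_mult) simp
    qed simp
    finally show "card ?W \<le> 4 ^ card A" .
  qed
  have fin: "finite (?W \<times> permutations_of_set A)" using W by simp
  show "finite (trees_on d p A)"
    using inj_on_finite[OF inj sub fin] .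
  have "card (trees_on d p A) \<le> card (?W \<times> permutations_of_set A)"
    by (rule card_inj_on_le[OF inj sub fin])
  also have "\<dots> \<le> 4 ^ card A * fact (card A)"
    unfolding card_cartesian_product using W assms by (simp add: mult_le_mono1)
  finally show "card (trees_on d p A) \<le> 4 ^ card A * fact (card A)" .
qed

lemma LT_eq: "LT d n = trees_on d (\<lambda>_. True) {1..n}"
  by (simp add: LT_def trees_on_def)

text \<open>The exponent \<open>n - 1\<close> is the one in the theorem. Passing from
  \<open>4 ^ n\<close> to \<open>16 ^ (n - 1)\<close> requires \<open>n \<le> 2 * (n - 1)\<close>,
  so \<open>n = 1\<close>, where the only tree is a leaf, is separate.\<close>

lemma card_LT_le:
  assumes "d \<ge> 2" "n \<ge> 1"
  shows "card (LT d n) \<le> 16 ^ (n - 1) * fact n"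
proof (cases "n = 1")
  case True
  have "LT d 1 \<subseteq> {Leaf 1}"
  proof
    fix t assume t: "t \<in> LT d 1"
    then have "distinct (leaves t)" "set (leaves t) = {1..1}" by (simp_all add: LT_def)
    then have "length (leaves t) = 1" using distinct_card[of "leaves t"] by simp
    moreover have "length (leaves t) = 1 + (d - 1) * num_internal t"
      using t assms by (intro length_leaves) (auto simp: LT_def)
    ultimately have "num_internal t = 0" using assms by simp
    then obtain a where "t = Leaf a" by (cases t) auto
    with \<open>set (leaves t) = {1..1}\<close> show "t \<in> {Leaf 1}" by simp
  qed
  from card_mono[OF _ this] True show ?thesis by simp
next
  case False
  have "(4::nat) ^ n \<le> 4 ^ (2 * (n - 1))"
    using False assms by (intro power_increasing) auto
  then have "(4::nat) ^ n \<le> 16 ^ (n - 1)" by (simp add: power_mult)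
  moreover have "card (LT d n) \<le> 4 ^ n * fact n"
    using card_trees_on(2)[of d "{1..n}" "\<lambda>_. True"] assms by (simp add: LT_eq)
  ultimately show ?thesis by (meson le_trans mult_le_mono1)
qed

section \<open>Left combs and trees with short left runs\<close>

text \<open>Vertices are counted, not edges: a vertex whose first child is a leaf has run
  \<open>1\<close>.\<close>

fun left_run :: "'a ptree \<Rightarrow> nat" where
  "left_run (Leaf a) = 0"
| "left_run (Node []) = 1"
| "left_run (Node (t # ts)) = Suc (left_run t)"

fun left_runs_le :: "nat \<Rightarrow> 'a ptree \<Rightarrow> bool" where
  "left_runs_le r (Leaf a) \<longleftrightarrow> True"
| "left_runs_le r (Node ts) \<longleftrightarrow> left_run (Node ts) \<le> r \<and> (\<forall>t\<in>set ts. left_runs_le r t)"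

fun is_leaf :: "'a ptree \<Rightarrow> bool" where
  "is_leaf (Leaf a) \<longleftrightarrow> True"
| "is_leaf (Node ts) \<longleftrightarrow> False"

fun left_comb :: "'a ptree \<Rightarrow> bool" where
  "left_comb (Leaf a) \<longleftrightarrow> True"
| "left_comb (Node []) \<longleftrightarrow> True"
| "left_comb (Node (t # ts)) \<longleftrightarrow> left_comb t \<and> (\<forall>s\<in>set ts. is_leaf s)"

lemma is_leaf_iff: "is_leaf t \<longleftrightarrow> (\<exists>a. t = Leaf a)"
  by (cases t) auto

lemma left_comb_leaf: "is_leaf t \<Longrightarrow> left_comb t"
  by (cases t) auto

text \<open>All internal vertices of a left comb lie on the path of first children. Hence a comb
  with more than \<open>r\<close> of them violates \<open>left_runs_le r\<close>.\<close>

lemma num_internal_left_comb: "left_comb t \<Longrightarrow> num_internal t = left_run t"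
proof (induction t rule: left_comb.induct)
  case (3 t ts)
  then have "\<forall>s\<in>set ts. num_internal s = 0" by (auto simp: is_leaf_iff)
  then have "sum_list (map num_internal ts) = 0" by (simp add: sum_list_eq_0_iff)
  with 3 show ?case by simp
qed auto

lemma left_run_le: "left_runs_le r t \<Longrightarrow> left_run t \<le> r"
  by (cases t) auto

section \<open>Classes of trees closed under taking patterns\<close>

text \<open>These are the three operations that lead from a tree to a standardised subtree: descend
  to a vertex, truncate, relabel.\<close>

definition shape_closed :: "(nat ptree \<Rightarrow> bool) \<Rightarrow> bool" where
  "shape_closed p \<longleftrightarrow> (\<forall>t f. p t \<longrightarrow> p (relabel f t)) \<and> (\<forall>t S. truncation S t \<longrightarrow> p t \<longrightarrow> p S)
     \<and> (\<forall>t. \<forall>s\<in>vertex_trees t. p t \<longrightarrow> p s)"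

text \<open>If \<open>P\<close> occurred in \<open>t\<close>, closure would carry \<open>p\<close>
  from \<open>t\<close> over to \<open>P\<close>.\<close>

lemma avoids_if_shape_closed:
  assumes "shape_closed p" "p t" "\<not> p P"
  shows "avoids t P"
  using assms unfolding avoids_def is_subtree_def standardise_def shape_closed_def by metis

lemma left_run_relabel [simp]: "left_run (relabel f t) = left_run t"
  by (induction t rule: left_run.induct) auto

lemma is_leaf_relabel [simp]: "is_leaf (relabel f t) = is_leaf t"
  by (cases t) auto

lemma left_run_truncation: "truncation S t \<Longrightarrow> left_run S \<le> left_run t"
proof (induction rule: truncation.induct)
  case (keep ss ts)
  then show ?case by (cases ss; cases ts) auto
qed simp

lemma is_leaf_truncation: "truncation S t \<Longrightarrow> is_leaf t \<Longrightarrow> is_leaf S"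
  by (induction rule: truncation.induct) auto

lemma shape_closed_left_runs_le: "shape_closed (left_runs_le r)"
proof -
  have "left_runs_le r (relabel f t)" if "left_runs_le r t" for t :: "nat ptree" and f :: "nat \<Rightarrow> nat"
    using that
  proof (induction t)
    case (Node ts)
    then show ?case using left_run_relabel[of f "Node ts"] by auto
  qed simp
  moreover have "left_runs_le r S" if "truncation S t" "left_runs_le r t" for S t :: "nat ptree"
    using that
  proof (induction rule: truncation.induct)
    case (keep ss ts)
    have "truncation (Node ss) (Node ts)"
      using keep.IH by (intro truncation.keep) (auto elim: list_all2_mono)
    then have "left_run (Node ss) \<le> r" using left_run_truncation keep.prems by fastforce
    moreover have "left_runs_le r s" if "s \<in> set ss" for s
      using that keep by (fastforce simp: list_all2_conv_all_nth in_set_conv_nth)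
    ultimately show ?case by simp
  qed simp
  moreover have "left_runs_le r s" if "s \<in> vertex_trees t" "left_runs_le r t" for s t :: "nat ptree"
    using that by (induction t) auto
  ultimately show ?thesis by (auto simp: shape_closed_def)
qed

lemma shape_closed_left_comb: "shape_closed left_comb"
proof -
  have "left_comb (relabel f t)" if "left_comb t" for t :: "nat ptree" and f :: "nat \<Rightarrow> nat"
    using that by (induction t rule: left_comb.induct) auto
  moreover have "left_comb S" if "truncation S t" "left_comb t" for S t :: "nat ptree"
    using that
  proof (induction rule: truncation.induct)
    case (keep ss ts)
    show ?case
    proof (cases ss)
      case (Cons u us)
      with keep obtain v vs where ts: "ts = v # vs" by (cases ts) auto
      have "list_all2 truncation us vs"
        using keep.IH Cons ts by (auto elim: list_all2_mono)
      \<comment> \<open>A truncation of a leaf is a leaf, so the non-first children remain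
        leaves.\<close>
      moreover have "\<forall>s\<in>set vs. is_leaf s" using keep.prems ts by simp
      ultimately have "is_leaf s" if "s \<in> set us" for s
        using that is_leaf_truncation by (fastforce simp: list_all2_conv_all_nth in_set_conv_nth)
      with keep Cons ts show ?thesis by auto
    qed simp
  qed simp
  moreover have "left_comb s" if "s \<in> vertex_trees t" "left_comb t" for s t :: "nat ptree"
    using that
  proof (induction t)
    case (Node ts)
    then show ?case by (cases ts) (auto dest: left_comb_leaf)
  qed simp
  ultimately show ?thesis by (auto simp: shape_closed_def)
qed

lemma trees_on_subset_LT_avoiding:
  assumes "shape_closed p" "\<not> p P"
  shows "trees_on d p {1..n} \<subseteq> LT_avoiding d P n"
  using avoids_if_shape_closed[OF assms(1) _ assms(2)]
  by (auto simp: trees_on_def LT_avoiding_def LT_def)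

section \<open>Counting left combs\<close>

lemma Min_trees_on: "t \<in> trees_on d p A \<Longrightarrow> min_label t = Min A"
  by (simp add: trees_on_def min_label_eq)

lemma concat_map_leaves_Leaf [simp]: "concat (map leaves (map Leaf xs)) = xs"
  by (induction xs) auto

text \<open>\<open>Min A\<close> stays in the first child, so the root is increasing as soon as its
  leaf children are sorted; \<open>B\<close> is otherwise free.\<close>

lemma Node_left_comb_in_trees_on:
  assumes A: "finite A" "A \<noteq> {}" and B: "B \<subseteq> A - {Min A}" "card B = d - 1" and d: "d \<ge> 1"
    and t: "t \<in> trees_on d left_comb (A - B)"
  shows "Node (t # map Leaf (sorted_list_of_set B)) \<in> trees_on d left_comb A"
proof -
  have fin: "finite B" using A B finite_subset by blast
  have "Min A \<in> A - B" using A B by auto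
  then have "Min (A - B) = Min A" using A by (intro Min_eqI) auto
  then have "min_label t = Min A" using Min_trees_on[OF t] by simp
  moreover have "Min A < b" if "b \<in> B" for b
    using that A B Min_le[of A b] by (metis DiffE in_mono insertI1 order_le_less)
  ultimately have "sorted_wrt (<) (map min_label (t # map Leaf (sorted_list_of_set B)))"
    using fin by (simp add: comp_def)
  then show ?thesis using t B d fin
    by (auto simp: trees_on_def simp del: map_map)
qed

text \<open>The labels of the \<open>d - 1\<close> leaf children at each level form any subset of
  the remaining labels without the minimum. The product of the binomials is the multinomial
  \<open>((d - 1) * m)! / (d - 1)! ^ m\<close>, stated here without division.\<close>

lemma card_left_combs:
  assumes "d \<ge> 2"
  shows "finite A \<Longrightarrow> card A = 1 + (d - 1) * m \<Longrightarrow>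
    fact (card A - 1) \<le> fact (d - 1) ^ m * card (trees_on d left_comb A)"
proof (induction m arbitrary: A)
  case 0
  then obtain a where "A = {a}" by (auto simp: card_1_singleton_iff)
  then have "Leaf a \<in> trees_on d left_comb A" by (simp add: trees_on_def)
  then have "card (trees_on d left_comb A) > 0"
    using card_trees_on(1)[OF assms] 0 by (auto simp: card_gt_0_iff)
  with 0 show ?case by simp
next
  case (Suc m)
  let ?c = "1 + (d - 1) * m"
  define S where "S = {B. B \<subseteq> A - {Min A} \<and> card B = d - 1}"
  have A: "A \<noteq> {}" using Suc.prems by auto
  have cA: "card (A - {Min A}) = (d - 1) * Suc m"
    using card_Diff_singleton[OF Min_in[OF Suc.prems(1) A]] Suc.prems(2) by simp
  have S: "finite S" "card S = ((d - 1) * Suc m) choose (d - 1)"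
    using n_subsets[of "A - {Min A}" "d - 1"] Suc.prems cA
    by (auto simp: S_def)
  let ?f = "\<lambda>(B, t). Node (t # map Leaf (sorted_list_of_set B))"
  let ?D = "SIGMA B:S. trees_on d left_comb (A - B)"
  have finB: "finite B" if "B \<in> S" for B
    using that Suc.prems by (auto simp: S_def intro: finite_subset)
  have "inj_on ?f ?D"
  proof (rule inj_onI)
    fix x y assume xy: "x \<in> ?D" "y \<in> ?D" "?f x = ?f y"
    obtain B t C u where [simp]: "x = (B, t)" "y = (C, u)" by (cases x; cases y)
    have eq: "t = u" "map Leaf (sorted_list_of_set B) = map Leaf (sorted_list_of_set C)"
      using xy(3) by simp_all
    then have "sorted_list_of_set B = sorted_list_of_set C"
      by (metis concat_map_leaves_Leaf)
    moreover have "finite B" "finite C" using xy finB by auto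
    ultimately have "B = C" by (metis set_sorted_list_of_set)
    with eq show "x = y" by simp
  qed
  moreover have "?f ` ?D \<subseteq> trees_on d left_comb A"
    using Node_left_comb_in_trees_on[of A] Suc.prems A assms by (auto simp: S_def)
  ultimately have "card ?D \<le> card (trees_on d left_comb A)"
    using card_trees_on(1)[OF assms] Suc.prems by (intro card_inj_on_le) auto
  moreover have "card ?D = (\<Sum>B\<in>S. card (trees_on d left_comb (A - B)))"
    using S card_trees_on(1)[OF assms] Suc.prems by (intro card_SigmaI) auto
  ultimately have D: "(\<Sum>B\<in>S. card (trees_on d left_comb (A - B))) \<le> card (trees_on d left_comb A)"
    by simp
  have each: "fact ((d - 1) * m) \<le> fact (d - 1) ^ m * card (trees_on d left_comb (A - B))"
    if "B \<in> S" for B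
  proof -
    have "card (A - B) = ?c" using that Suc.prems finB[OF that]
      by (subst card_Diff_subset) (auto simp: S_def)
    with Suc.IH[of "A - B"] Suc.prems show ?thesis by simp
  qed
  have "fact (card A - 1) = fact (d - 1) * (card S * fact ((d - 1) * m))"
    using binomial_fact_lemma[of "d - 1" "(d - 1) * Suc m"] S Suc.prems by (simp add: mult_ac)
  also have "card S * fact ((d - 1) * m) \<le>
      (\<Sum>B\<in>S. fact (d - 1) ^ m * card (trees_on d left_comb (A - B)))"
    using sum_mono[of S, OF each] by simp
  also have "\<dots> \<le> fact (d - 1) ^ m * card (trees_on d left_comb A)"
    using D by (simp flip: sum_distrib_left)
  finally show ?case by (simp add: mult_ac)
qed

section \<open>Counting trees with short left runs\<close>

text \<open>
  The factor \<open>x ^ r\<close> makes the bound reproduce itself: at a balanced vertex the product of the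
  two factors \<open>(x1 * x2) ^ r\<close> exceeds \<open>x ^ r\<close> by the polynomial loss.
\<close>

definition balanced_bound :: "real \<Rightarrow> nat \<Rightarrow> nat \<Rightarrow> real" where
  "balanced_bound c r x = c ^ (x - 1) * fact x * real x ^ r"

section \<open>The numerical recursion\<close>

text \<open>The quotient of the factorials is a product of \<open>r + 1\<close> factors, each at
  most \<open>N + r\<close>.\<close>

lemma fact_add_le: "N \<ge> 1 \<Longrightarrow> (fact (N + r) :: real) \<le> fact (N - 1) * real (N + r) ^ (r + 1)"
proof (induction r)
  case 0
  then show ?case by (simp add: fact_reduce)
next
  case (Suc r)
  have "(fact (N + Suc r) :: real) = real (N + Suc r) * fact (N + r)" by simp
  also have "\<dots> \<le> real (N + Suc r) * (fact (N - 1) * real (N + r) ^ (r + 1))"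
    using Suc by (intro mult_left_mono) auto
  also have "\<dots> \<le> real (N + Suc r) * (fact (N - 1) * real (N + Suc r) ^ (r + 1))"
    by (intro mult_left_mono power_mono) auto
  finally show ?case by (simp add: mult_ac)
qed

text \<open>The induction step of the tree counts: \<open>r\<close> labels are spent at the top, the
  others are split into parts of sizes \<open>n1\<close> and \<open>n2\<close>. Each part is at
  least \<open>(n1 + n2 + r) / (2 + s + r)\<close>, so \<open>n1 ^ (r + 1) * n2 ^ r\<close> makes up
  for \<open>(n1 + n2 + r) ^ (2 * r + 1)\<close> up to a constant, which surplus factors of
  \<open>c\<close> absorb.\<close>

lemma balanced_bound_split:
  fixes r s n1 n2 :: nat
  assumes n: "n1 \<ge> 1" "n2 \<ge> 1" "n1 \<le> n2 + s" "n2 \<le> n1 + s"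
  defines "c \<equiv> 1 / real (2 + s + r) ^ 2"
  shows "balanced_bound c r (n1 + n2 + r) \<le>
    real ((n1 + n2 - 1) choose (n1 - 1)) * balanced_bound c r n1 * balanced_bound c r n2"
proof -
  let ?N = "n1 + n2" and ?\<delta> = "real (2 + s + r)"
  have c: "0 < c" by (simp add: c_def)
  \<comment> \<open>For instance \<open>?N + r \<le> 2 * n1 + s + r\<close>, and
    \<open>s + r \<le> (s + r) * n1\<close>.\<close>
  have "?N + r \<le> (2 + s + r) * n1" "?N + r \<le> (2 + s + r) * n2"
    using n mult_le_mono2[of 1 n1 "s + r"] mult_le_mono2[of 1 n2 "s + r"]
    by (auto simp: algebra_simps)
  then have le: "real (?N + r) \<le> ?\<delta> * n1" "real (?N + r) \<le> ?\<delta> * n2"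
    by (metis of_nat_le_iff of_nat_mult)+
  have \<delta>: "0 < ?\<delta> ^ (2 * r + 2)" by simp
  have c\<delta>: "c ^ (r + 1) = 1 / ?\<delta> ^ (2 * r + 2)"
    by (simp only: c_def power_one_over flip: power_mult) simp
  have "real (?N + r) ^ (r + 1) * real (?N + r) ^ r
      = real (?N + r) * real (?N + r) ^ r * real (?N + r) ^ r" by simp
  also have "\<dots> \<le> (?\<delta> * n1) * (?\<delta> * n1) ^ r * (?\<delta> * n2) ^ r"
    by (intro mult_mono power_mono le) auto
  also have "\<dots> = ?\<delta> ^ (2 * r + 1) * (n1 * (real n1 ^ r * real n2 ^ r))"
    by (simp only: power_mult_distrib power_add power_mult power2_eq_square power_one_right mult_ac)
  \<comment> \<open>One power of \<open>?\<delta>\<close> is given away to match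
    \<open>c ^ (r + 1)\<close>, since \<open>c\<close> is an inverse square.\<close>
  also have "\<dots> \<le> ?\<delta> ^ (2 * r + 2) * (n1 * (real n1 ^ r * real n2 ^ r))"
    by (intro mult_right_mono power_increasing) auto
  finally have poly: "c ^ (r + 1) * (real (?N + r) ^ (r + 1) * real (?N + r) ^ r)
      \<le> n1 * (real n1 ^ r * real n2 ^ r)"
    unfolding c\<delta> times_divide_eq_left mult_1_left pos_divide_le_eq[OF \<delta>] by (simp only: mult_ac)
  \<comment> \<open>The binomial fixes the minimum in the first part, hence
    \<open>(?N - 1)! * n1\<close> rather than \<open>?N!\<close>; the lost factor is part of the
    polynomial loss.\<close>
  have "fact (n1 - 1) * fact (?N - 1 - (n1 - 1)) * ((?N - 1) choose (n1 - 1)) = (fact (?N - 1) :: nat)"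
    using n by (intro binomial_fact_lemma) simp
  moreover have "?N - 1 - (n1 - 1) = n2" using n by simp
  ultimately have "real (fact (n1 - 1) * fact n2 * ((?N - 1) choose (n1 - 1))) = real (fact (?N - 1))"
    by simp
  then have "fact (?N - 1) = fact (n1 - 1) * fact n2 * real ((?N - 1) choose (n1 - 1))"
    by simp
  then have fct: "real ((?N - 1) choose (n1 - 1)) * (fact n1 * fact n2) = fact (?N - 1) * real n1"
    using n by (simp add: fact_reduce[of n1] mult_ac)
  have "balanced_bound c r (?N + r)
      \<le> c ^ (?N + r - 1) * (fact (?N - 1) * real (?N + r) ^ (r + 1)) * real (?N + r) ^ r"
    unfolding balanced_bound_def using fact_add_le[of ?N r] n c
    by (intro mult_right_mono mult_left_mono) auto
  \<comment> \<open>The two parts use only \<open>(n1 - 1) + (n2 - 1) = ?N - 2\<close> factors of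
    \<open>c\<close>, which leaves \<open>r + 1\<close> to pay for the loss.\<close>
  also have "c ^ (?N + r - 1) = c ^ (?N - 2) * c ^ (r + 1)"
    unfolding power_add[symmetric] using n by (intro arg_cong[where f = "power c"]) simp
  also have "c ^ (?N - 2) * c ^ (r + 1) * (fact (?N - 1) * real (?N + r) ^ (r + 1)) * real (?N + r) ^ r
      = c ^ (?N - 2) * fact (?N - 1) * (c ^ (r + 1) * (real (?N + r) ^ (r + 1) * real (?N + r) ^ r))"
    by (simp only: mult_ac)
  also have "\<dots> \<le> c ^ (?N - 2) * fact (?N - 1) * (n1 * (real n1 ^ r * real n2 ^ r))"
    using c by (intro mult_left_mono poly) auto
  also have "\<dots> = c ^ (?N - 2) * (real n1 ^ r * real n2 ^ r) * (fact (?N - 1) * real n1)"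
    by (simp only: mult_ac)
  also have "\<dots> = c ^ ((n1 - 1) + (n2 - 1)) * (real n1 ^ r * real n2 ^ r) *
      (real ((?N - 1) choose (n1 - 1)) * (fact n1 * fact n2))"
    using n fct by (simp add: numeral_2_eq_2)
  also have "\<dots> = real ((?N - 1) choose (n1 - 1)) * balanced_bound c r n1 * balanced_bound c r n2"
    by (simp only: balanced_bound_def power_add mult_ac)
  finally show ?thesis .
qed

section \<open>Gluing two trees over a split label set\<close>

lemma card_subsets_with_Min:
  assumes "finite A" "card A = n1 + n2" "n1 \<ge> 1"
  shows "card {B. B \<subseteq> A \<and> Min A \<in> B \<and> card B = n1} = (n1 + n2 - 1) choose (n1 - 1)"
proof -
  have A: "Min A \<in> A" using assms by (intro Min_in) auto
  have "bij_betw (insert (Min A)) {B. B \<subseteq> A - {Min A} \<and> card B = n1 - 1}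
    {B. B \<subseteq> A \<and> Min A \<in> B \<and> card B = n1}"
  proof (rule bij_betw_byWitness[where f' = "\<lambda>B. B - {Min A}"])
    show "insert (Min A) ` {B. B \<subseteq> A - {Min A} \<and> card B = n1 - 1} \<subseteq>
        {B. B \<subseteq> A \<and> Min A \<in> B \<and> card B = n1}"
    proof (clarify, intro conjI)
      fix B assume B: "B \<subseteq> A - {Min A}" "card B = n1 - 1"
      then have "finite B" "Min A \<notin> B" using assms finite_subset by blast+
      with B assms show "card (insert (Min A) B) = n1" by simp
    qed (use A in auto)
  qed auto
  then have "card {B. B \<subseteq> A \<and> Min A \<in> B \<and> card B = n1} =
      card {B. B \<subseteq> A - {Min A} \<and> card B = n1 - 1}"
    by (simp add: bij_betw_same_card)
  also have "\<dots> = (n1 + n2 - 1) choose (n1 - 1)"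
    using n_subsets[of "A - {Min A}" "n1 - 1"] A assms by simp
  finally show ?thesis .
qed

text \<open>The recursion common to both arities; \<open>F\<close> is the gluing, which differs
  between them. Demanding \<open>Min A'\<close> in \<open>B\<close> decides which of the two trees
  comes first, as the increasing condition requires.\<close>

lemma card_trees_on_split:
  assumes d: "d \<ge> 2" and A: "finite A" and A': "finite A'" "card A' = n1 + n2"
    and n: "n1 \<ge> 1" "n2 \<ge> 1"
    and F: "\<And>B t1 t2. B \<subseteq> A' \<Longrightarrow> Min A' \<in> B \<Longrightarrow> B \<noteq> A' \<Longrightarrow> t1 \<in> trees_on d p B \<Longrightarrow>
      t2 \<in> trees_on d p (A' - B) \<Longrightarrow> F t1 t2 \<in> trees_on d p A"
    and inj: "\<And>t1 t2 u1 u2. F t1 t2 = F u1 u2 \<Longrightarrow> t1 = u1 \<and> t2 = u2"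
    and b: "\<And>B. finite B \<Longrightarrow> card B = n1 \<Longrightarrow> b1 \<le> real (card (trees_on d p B))"
      "\<And>B. finite B \<Longrightarrow> card B = n2 \<Longrightarrow> b2 \<le> real (card (trees_on d p B))"
    and pos: "b1 \<ge> 0" "b2 \<ge> 0"
  shows "real ((n1 + n2 - 1) choose (n1 - 1)) * b1 * b2 \<le> real (card (trees_on d p A))"
proof -
  define S where "S = {B. B \<subseteq> A' \<and> Min A' \<in> B \<and> card B = n1}"
  have S: "finite S" "card S = (n1 + n2 - 1) choose (n1 - 1)"
    using card_subsets_with_Min[OF A' n(1)] A' by (auto simp: S_def)
  have finB: "finite B" if "B \<in> S" for B
    using that A' by (auto simp: S_def intro: finite_subset)
  let ?D = "SIGMA B:S. trees_on d p B \<times> trees_on d p (A' - B)"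
  let ?f = "\<lambda>(B, t1, t2). F t1 t2"
  have "inj_on ?f ?D"
  proof (rule inj_onI)
    fix x y assume xy: "x \<in> ?D" "y \<in> ?D" "?f x = ?f y"
    obtain B t1 t2 C u1 u2 where [simp]: "x = (B, t1, t2)" "y = (C, u1, u2)"
      by (metis prod_cases3)
    \<comment> \<open>\<open>B\<close> is recovered as the label set of \<open>t1\<close>.\<close>
    show "x = y"
      using xy inj[of t1 t2 u1 u2] by (auto simp: trees_on_def)
  qed
  moreover have "?f ` ?D \<subseteq> trees_on d p A"
  proof clarify
    fix B t1 t2 assume "B \<in> S" "t1 \<in> trees_on d p B" "t2 \<in> trees_on d p (A' - B)"
    moreover from this have "B \<noteq> A'" using A' n by (auto simp: S_def)
    ultimately show "F t1 t2 \<in> trees_on d p A" by (intro F[of B]) (auto simp: S_def)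
  qed
  ultimately have le: "card ?D \<le> card (trees_on d p A)"
    using card_trees_on(1)[OF d A] by (intro card_inj_on_le) auto
  have "card ?D = (\<Sum>B\<in>S. card (trees_on d p B) * card (trees_on d p (A' - B)))"
    using S finB card_trees_on(1)[OF d] A' by (subst card_SigmaI) (auto simp: card_cartesian_product)
  then have "real (card ?D) =
      (\<Sum>B\<in>S. real (card (trees_on d p B)) * real (card (trees_on d p (A' - B))))"
    by simp
  also have "\<dots> \<ge> (\<Sum>B\<in>S. b1 * b2)"
  proof (rule sum_mono)
    fix B assume B: "B \<in> S"
    then have "card B = n1" "card (A' - B) = n2" using A' finB[OF B]
      by (auto simp: S_def card_Diff_subset)
    then show "b1 * b2 \<le> real (card (trees_on d p B)) * real (card (trees_on d p (A' - B)))"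
      using finB[OF B] A' pos by (intro mult_mono b) auto
  qed
  finally show ?thesis using le S by (simp add: mult.assoc)
qed

lemma card_trees_on_singleton:
  assumes "d \<ge> 2" "p (Leaf a)"
  shows "1 \<le> card (trees_on d p {a})"
proof -
  have "Leaf a \<in> trees_on d p {a}" using assms by (simp add: trees_on_def)
  then show ?thesis
    using card_trees_on(1)[OF assms(1), of "{a}" p] by (simp add: Suc_le_eq card_gt_0_iff) blast
qed

lemma Min_part_less:
  fixes A :: "nat set"
  assumes "finite A" "B \<subseteq> A" "Min A \<in> B" "B \<noteq> A"
  shows "Min B = Min A" "Min A < Min (A - B)"
proof -
  show "Min B = Min A" using assms by (intro Min_eqI) (auto intro: finite_subset)
  have "Min (A - B) \<in> A - B" using assms by (intro Min_in) auto
  then have "Min (A - B) \<in> A" "Min (A - B) \<noteq> Min A" using assms by auto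
  with assms show "Min A < Min (A - B)" by (metis Min_le order_le_less)
qed

section \<open>Binary trees\<close>

text \<open>Runs of length \<open>1\<close> would force every first child to be a leaf and leave a
  single tree for each label set, so length \<open>2\<close> is allowed. In
  \<open>Node [Node [Leaf a, t1], t2]\<close> with \<open>a\<close> minimal the root has run
  \<open>2\<close>, and both \<open>t1\<close> and \<open>t2\<close> sit at second children, where
  new runs start.\<close>

lemma card_left_runs_le_2:
  assumes "finite A" "card A \<ge> 1"
  shows "balanced_bound (1 / 16) 1 (card A) \<le> real (card (trees_on 2 (left_runs_le 2) A))"
  using assms
proof (induction "card A" arbitrary: A rule: less_induct)
  case less
  note A = less.prems
  let ?a = "Min A" and ?A' = "A - {Min A}"
  have a: "?a \<in> A" using A by (intro Min_in) auto
  have lt: "?a < b" if "b \<in> ?A'" for b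
    using that A Min_le[of A b] by (simp add: order_le_less)
  consider "card A = 1" | "card A = 2" | "card A \<ge> 3" using A by linarith
  then show ?case
  proof cases
    case 1
    then obtain x where "A = {x}" by (auto simp: card_1_singleton_iff)
    then show ?thesis
      using card_trees_on_singleton[of 2 "left_runs_le 2" x] by (simp add: balanced_bound_def)
  next
    \<comment> \<open>A single label remains beside the minimum and cannot be split; the bound is
      \<open>1 / 4\<close> here and one tree is enough.\<close>
    case 2
    then have "card ?A' = 1" using A a by simp
    then obtain b where b: "?A' = {b}" by (auto simp: card_1_singleton_iff)
    then have "A = {?a, b}" "?a < b" using a lt by auto
    then have "Node [Leaf ?a, Leaf b] \<in> trees_on 2 (left_runs_le 2) A"
      by (auto simp: trees_on_def)
    then have "1 \<le> card (trees_on 2 (left_runs_le 2) A)"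
      using card_trees_on(1)[of 2 A "left_runs_le 2"] A by (simp add: Suc_le_eq card_gt_0_iff) blast
    then show ?thesis using 2 by (simp add: balanced_bound_def numeral_2_eq_2)
  next
    case 3
    define n1 where "n1 = (card A - 1) div 2"
    define n2 where "n2 = card A - 1 - n1"
    have n: "n1 \<ge> 1" "n2 \<ge> 1" "n1 \<le> n2 + 1" "n2 \<le> n1 + 1" "card A = n1 + n2 + 1"
      using 3 by (auto simp: n1_def n2_def)
    have cA': "card ?A' = n1 + n2" using A a n by simp
    \<comment> \<open>One label is spent and the halves differ by at most one:
      \<open>r = s = 1\<close>, so the constant is \<open>1 / 4 ^ 2\<close>.\<close>
    have "balanced_bound (1 / 16) 1 (card A) \<le> real ((n1 + n2 - 1) choose (n1 - 1)) *
        balanced_bound (1 / 16) 1 n1 * balanced_bound (1 / 16) 1 n2"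
      using balanced_bound_split[OF n(1-4), of 1] n(5) by (simp add: power2_eq_square)
    also have "\<dots> \<le> real (card (trees_on 2 (left_runs_le 2) A))"
    proof (rule card_trees_on_split[where A' = ?A' and F = "\<lambda>t1 t2. Node [Node [Leaf ?a, t1], t2]"])
      fix B t1 t2
      assume B: "B \<subseteq> ?A'" "Min ?A' \<in> B" "B \<noteq> ?A'"
        and t: "t1 \<in> trees_on 2 (left_runs_le 2) B" "t2 \<in> trees_on 2 (left_runs_le 2) (?A' - B)"
      have ne: "?A' \<noteq> {}" "B \<noteq> {}" "?A' - B \<noteq> {}" "finite B" using B A finite_subset by auto
      have "?a < Min B" using lt B ne Min_in[of B] by blast
      moreover have "?a < Min (?A' - B)" using lt ne A Min_in[of "?A' - B"] by blast
      moreover have "min_label t1 = Min B" "min_label t2 = Min (?A' - B)"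
        using t by (simp_all add: Min_trees_on)
      moreover have "min_label (Node [Leaf ?a, t1]) = ?a"
      proof -
        have "set (leaves t1) = B" using t by (simp add: trees_on_def)
        then have "min_label (Node [Leaf ?a, t1]) = Min (insert ?a B)" by (simp add: min_label_eq)
        also have "\<dots> = ?a" using ne \<open>?a < Min B\<close> by (subst Min_insert) auto
        finally show ?thesis .
      qed
      ultimately show "Node [Node [Leaf ?a, t1], t2] \<in> trees_on 2 (left_runs_le 2) A"
        using t B a by (auto simp: trees_on_def)
    qed (use n A cA' less.hyps in \<open>auto simp: balanced_bound_def\<close>)
    finally show ?thesis .
  qed
qed

section \<open>Arity at least three\<close>

text \<open>Supplies the smallest labels, which go to the leading leaf children of a vertex.\<close>

lemma initial_labels:
  assumes "finite A" "r \<le> card A"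
  obtains as A' where "sorted_wrt (<) as" "distinct as" "length as = r" "A = set as \<union> A'"
    "set as \<inter> A' = {}" "\<And>x y. x \<in> set as \<Longrightarrow> y \<in> A' \<Longrightarrow> x < (y::nat)" "card A' = card A - r"
proof
  let ?xs = "sorted_list_of_set A"
  let ?as = "take r ?xs" and ?A' = "set (drop r ?xs)"
  have app: "?as @ drop r ?xs = ?xs" by simp
  have s: "sorted_wrt (<) (?as @ drop r ?xs)" unfolding app by simp
  have di: "distinct (?as @ drop r ?xs)" unfolding app by simp
  show "sorted_wrt (<) ?as" using s sorted_wrt_append by blast
  show "x < y" if "x \<in> set ?as" "y \<in> ?A'" for x y
    using s that unfolding sorted_wrt_append by blast
  show "distinct ?as" "set ?as \<inter> ?A' = {}" using di unfolding distinct_append by blast+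
  show "length ?as = r" using assms by simp
  show "A = set ?as \<union> ?A'" using assms by (metis app set_append set_sorted_list_of_set)
  show "card ?A' = card A - r" using assms by (subst distinct_card) simp_all
qed

text \<open>The root gets \<open>d - 2 \<ge> 1\<close> leading leaves with the smallest labels, then
  two balanced subtrees. Its first child is a leaf, so its run is \<open>1\<close>. This is the
  split with \<open>r = d - 2\<close> and \<open>s = d - 1\<close>.\<close>

lemma card_left_runs_le_1:
  assumes d: "d \<ge> 3"
  defines "c \<equiv> 1 / real (2 + (d - 1) + (d - 2)) ^ 2"
  shows "finite A \<Longrightarrow> card A = 1 + (d - 1) * m \<Longrightarrow>
    balanced_bound c (d - 2) (card A) \<le> real (card (trees_on d (left_runs_le 1) A))"
proof (induction m arbitrary: A rule: less_induct)
  case (less m)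
  note A = less.prems
  have c: "c > 0" using d by (simp add: c_def)
  show ?case
  proof (cases "m = 0")
    case True
    then obtain x where "A = {x}" using A by (auto simp: card_1_singleton_iff)
    then show ?thesis
      using card_trees_on_singleton[of d "left_runs_le 1" x] d by (simp add: balanced_bound_def)
  next
    case False
    \<comment> \<open>Internal vertices, not leaves, are halved: a subtree must have
      \<open>1\<close> modulo \<open>d - 1\<close> leaves. The sizes may then differ by
      \<open>d - 1\<close>.\<close>
    define m1 where "m1 = (m - 1) div 2"
    define m2 where "m2 = m - 1 - m1"
    define n1 where "n1 = 1 + (d - 1) * m1"
    define n2 where "n2 = 1 + (d - 1) * m2"
    have m: "m1 \<le> m2 + 1" "m2 \<le> m1 + 1" "m = m1 + m2 + 1" "m1 < m" "m2 < m"
      using False by (auto simp: m1_def m2_def)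
    have n: "n1 \<ge> 1" "n2 \<ge> 1" "n1 \<le> n2 + (d - 1)" "n2 \<le> n1 + (d - 1)"
      using mult_le_mono2[OF m(1), of "d - 1"] mult_le_mono2[OF m(2), of "d - 1"]
      by (auto simp: n1_def n2_def)
    have cA: "card A = n1 + n2 + (d - 2)"
      using A(2) m(3) d by (simp add: n1_def n2_def algebra_simps)
    obtain as A' where as: "sorted_wrt (<) as" "distinct as" "length as = d - 2" "A = set as \<union> A'"
      "set as \<inter> A' = {}" "\<And>x y. x \<in> set as \<Longrightarrow> y \<in> A' \<Longrightarrow> x < y" "card A' = card A - (d - 2)"
      using initial_labels[of A "d - 2"] A cA by (metis le_add2)
    obtain b bs where bs: "as = b # bs" using as(3) d by (cases as) auto
    have A': "finite A'" "card A' = n1 + n2" using as A cA by auto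
    have "balanced_bound c (d - 2) (card A) \<le> real ((n1 + n2 - 1) choose (n1 - 1)) *
        balanced_bound c (d - 2) n1 * balanced_bound c (d - 2) n2"
      using balanced_bound_split[OF n, of "d - 2"] cA by (simp add: c_def)
    also have "\<dots> \<le> real (card (trees_on d (left_runs_le 1) A))"
    proof (rule card_trees_on_split[where A' = A' and F = "\<lambda>t1 t2. Node (map Leaf as @ [t1, t2])"])
      fix B t1 t2
      assume B: "B \<subseteq> A'" "Min A' \<in> B" "B \<noteq> A'"
        and t: "t1 \<in> trees_on d (left_runs_le 1) B" "t2 \<in> trees_on d (left_runs_le 1) (A' - B)"
      have "min_label t1 = Min A'" "min_label t2 = Min (A' - B)"
        using t Min_part_less(1)[OF A'(1) B] by (simp_all add: Min_trees_on)
      moreover have "Min A' < Min (A' - B)" using Min_part_less(2)[OF A'(1) B] .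
      moreover have "Min A' \<in> A'" "Min (A' - B) \<in> A'" using B A' Min_in[of "A' - B"] by auto
      ultimately have "sorted_wrt (<) (map min_label (map Leaf as @ [t1, t2]))"
        using as(1,6) by (auto simp: sorted_wrt_append comp_def)
      moreover have "left_run (Node (map Leaf as @ [t1, t2])) = 1" by (simp add: bs)
      moreover have "distinct (leaves (Node (map Leaf as @ [t1, t2])))"
        "set (leaves (Node (map Leaf as @ [t1, t2]))) = A"
        using t B as(2,4,5) by (auto simp: trees_on_def simp del: map_map)
      moreover have "length (map Leaf as @ [t1, t2]) = d" using as(3) d by simp
      ultimately show "Node (map Leaf as @ [t1, t2]) \<in> trees_on d (left_runs_le 1) A"
        using t by (auto simp: trees_on_def simp del: leaves.simps map_append map_map)
    next
      show "balanced_bound c (d - 2) n1 \<le> real (card (trees_on d (left_runs_le 1) B))"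
        if "finite B" "card B = n1" for B
        using less.IH[of m1 B] that m by (simp add: n1_def)
      show "balanced_bound c (d - 2) n2 \<le> real (card (trees_on d (left_runs_le 1) B))"
        if "finite B" "card B = n2" for B
        using less.IH[of m2 B] that m by (simp add: n2_def)
    qed (use n A A' d c in \<open>auto simp: balanced_bound_def\<close>)
    finally show ?thesis .
  qed
qed

section \<open>The lower bound\<close>

lemma balanced_bound_ge:
  assumes "c > 0" "n \<ge> 1"
  shows "c ^ (n - 1) * fact n \<le> balanced_bound c r n"
  using assms mult_left_mono[of 1 "real n ^ r" "c ^ (n - 1) * fact n"]
  by (simp add: balanced_bound_def)

lemma left_runs_le_lower_bound:
  assumes "d \<ge> 2"
  shows "\<exists>c>0. \<forall>n m. n = 1 + (d - 1) * m \<longrightarrow>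
    c ^ (n - 1) * fact n \<le> real (card (trees_on d (left_runs_le (if d = 2 then 2 else 1)) {1..n}))"
proof (cases "d = 2")
  case True
  have "(1 / 16) ^ (n - 1) * fact n \<le> real (card (trees_on 2 (left_runs_le 2) {1..n}))" if "n \<ge> 1" for n
    using card_left_runs_le_2[of "{1..n}"] balanced_bound_ge[of "1/16" n 1] that by simp
  then have "\<forall>n m. n = 1 + (d - 1) * m \<longrightarrow>
      (1 / 16) ^ (n - 1) * fact n \<le> real (card (trees_on d (left_runs_le (if d = 2 then 2 else 1)) {1..n}))"
    unfolding True by (metis le_add1)
  then show ?thesis by (intro exI[of _ "1 / 16"]) auto
next
  case False
  let ?c = "1 / real (2 + (d - 1) + (d - 2)) ^ 2"
  have "?c ^ (n - 1) * fact n \<le> real (card (trees_on d (left_runs_le 1) {1..n}))"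
    if n: "n = 1 + (d - 1) * m" for n m
  proof -
    have "?c ^ (n - 1) * fact n \<le> balanced_bound ?c (d - 2) n"
      by (rule balanced_bound_ge) (use n assms in auto)
    also have "\<dots> \<le> real (card (trees_on d (left_runs_le 1) {1..n}))"
      using card_left_runs_le_1[of d "{1..n}" m] n False assms by simp
    finally show ?thesis .
  qed
  moreover have "?c > 0" using assms by simp
  ultimately show ?thesis using False by (intro exI[of _ ?c]) auto
qed

text \<open>Restates the comb count with exponent \<open>n - 1\<close> and with \<open>n!\<close> in
  place of \<open>(n - 1)!\<close>.\<close>

lemma left_comb_lower_bound:
  assumes d: "d \<ge> 2" and n: "n = 1 + (d - 1) * m"
  shows "(1 / (2 * fact (d - 1))) ^ (n - 1) * fact n \<le> real (card (trees_on d left_comb {1..n}))"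
proof -
  let ?K = "fact (d - 1) :: real" and ?x = "real (card (trees_on d left_comb {1..n}))"
  \<comment> \<open>The \<open>2\<close> in the constant pays for the missing factor
    \<open>n\<close>.\<close>
  have "n \<le> 2 ^ (n - 1)" using less_exp[of "n - 1"] n by linarith
  then have n2: "real n \<le> 2 ^ (n - 1)" by (metis of_nat_le_iff of_nat_numeral of_nat_power)
  have "fact (n - 1) \<le> fact (d - 1) ^ m * card (trees_on d left_comb {1..n})"
    using card_left_combs[OF d, of "{1..n}" m] n by simp
  then have "real (fact (n - 1)) \<le> real (fact (d - 1) ^ m * card (trees_on d left_comb {1..n}))"
    by (simp only: of_nat_le_iff)
  then have "fact (n - 1) \<le> ?K ^ m * ?x" by simp
  \<comment> \<open>\<open>m \<le> n - 1\<close> and \<open>?K \<ge> 1\<close>.\<close>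
  also have "\<dots> \<le> ?K ^ (n - 1) * ?x"
    using n d by (intro mult_right_mono power_increasing) (auto simp: fact_ge_1)
  finally have "fact (n - 1) \<le> ?K ^ (n - 1) * ?x" .
  then have "real n * fact (n - 1) \<le> 2 ^ (n - 1) * (?K ^ (n - 1) * ?x)"
    using n2 by (intro mult_mono) auto
  then have "fact n \<le> (2 * ?K) ^ (n - 1) * ?x"
    using n by (simp add: fact_reduce[of n] power_mult_distrib mult_ac)
  then show ?thesis by (simp add: power_divide field_simps)
qed

theorem mainTheorem5:
  fixes d k :: nat
  assumes "d \<ge> 2" and "k \<ge> 2"
    and "(d, k) \<notin> {(2, 2), (2, 3), (2, 4), (3, 2)}"
  shows "\<exists>C::real. C > 0 \<and>
    (\<forall>P \<in> (\<Union>l. LT d l). num_internal P = k \<longrightarrow>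
      (\<forall>n\<ge>1. real (card (LT_avoiding d P n)) \<ge> C ^ (n - 1) * real (card (LT d n))))"
proof -
  \<comment> \<open>The longest left run allowed in the counted trees; a left comb \<open>P\<close>
    has run \<open>k\<close>, which exceeds it.\<close>
  define r :: nat where "r = (if d = 2 then 2 else 1)"
  have k: "r < k" using assms by (auto simp: r_def)
  obtain c1 where c1: "c1 > 0" "\<And>n m. n = 1 + (d - 1) * m \<Longrightarrow>
      c1 ^ (n - 1) * fact n \<le> real (card (trees_on d (left_runs_le r) {1..n}))"
    using left_runs_le_lower_bound[OF assms(1)] unfolding r_def by blast
  \<comment> \<open>The minimum serves both kinds of pattern, so the constant is fixed before
    \<open>P\<close> is given.\<close>
  define c where "c = min c1 (1 / (2 * fact (d - 1)))"
  have c: "c > 0" using c1 by (simp add: c_def)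
  have main: "(c / 16) ^ (n - 1) * real (card (LT d n)) \<le> real (card (LT_avoiding d P n))"
    if P: "num_internal P = k" and n: "n \<ge> 1" for P n
  \<comment> \<open>A tree in \<open>LT d n\<close> shows that \<open>n\<close> has the form
    \<open>1 + (d - 1) * m\<close>, on which the lower bounds rest; without one the claim is
    trivial.\<close>
  proof (cases "LT d n = {}")
    case False
    then obtain t where t: "t \<in> LT d n" by auto
    define m where "m = num_internal t"
    have "n = length (leaves t)"
      using t distinct_card[of "leaves t"] by (simp add: LT_def)
    also have "\<dots> = 1 + (d - 1) * m"
      unfolding m_def using t assms by (intro length_leaves) (auto simp: LT_def)
    finally have nm: "n = 1 + (d - 1) * m" .
    have fin: "finite (LT_avoiding d P n)"
      using card_trees_on(1)[OF assms(1), of "{1..n}"]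
      by (auto simp: LT_avoiding_def LT_eq)
    have "c ^ (n - 1) * fact n \<le> real (card (LT_avoiding d P n))"
    proof (cases "left_comb P")
      case True
      then have "\<not> left_runs_le r P"
        using num_internal_left_comb[OF True] left_run_le[of r P] P k by auto
      then have "card (trees_on d (left_runs_le r) {1..n}) \<le> card (LT_avoiding d P n)"
        by (intro card_mono fin trees_on_subset_LT_avoiding shape_closed_left_runs_le)
      moreover have "c ^ (n - 1) * fact n \<le> c1 ^ (n - 1) * (fact n :: real)"
        using c by (intro mult_right_mono power_mono) (auto simp: c_def)
      ultimately show ?thesis using c1(2)[OF nm] by linarith
    next
      case False
      then have "card (trees_on d left_comb {1..n}) \<le> card (LT_avoiding d P n)"
        by (intro card_mono fin trees_on_subset_LT_avoiding shape_closed_left_comb)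
      moreover have "c ^ (n - 1) * fact n \<le> (1 / (2 * fact (d - 1))) ^ (n - 1) * (fact n :: real)"
        using c by (intro mult_right_mono power_mono) (auto simp: c_def)
      ultimately show ?thesis using left_comb_lower_bound[OF assms(1) nm] by linarith
    qed
    moreover have "real (card (LT d n)) \<le> real (16 ^ (n - 1) * fact n)"
      using card_LT_le[OF assms(1) n] by (simp only: of_nat_le_iff)
    then have "real (card (LT d n)) \<le> 16 ^ (n - 1) * fact n" by simp
    then have "(c / 16) ^ (n - 1) * real (card (LT d n)) \<le> (c / 16) ^ (n - 1) * (16 ^ (n - 1) * fact n)"
      using c by (intro mult_left_mono) auto
    then have "(c / 16) ^ (n - 1) * real (card (LT d n)) \<le> c ^ (n - 1) * fact n"
      by (simp add: power_divide)
    ultimately show ?thesis by linarith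
  qed simp
  show ?thesis
    using main c by (intro exI[of _ "c / 16"]) auto
qed

end
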